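(* Let $c$ be a real number larger than $1$, and let $\varphi$ denote Euler's totient function. Then the sequence $$\left(\sum_{m\le n}\frac{\varphi(\lfloor m^c\rfloor)}{\lfloor m^c\rfloor}\right)_{n\ge 1}$$ is dense modulo $1$, i.e. the set of fractional parts of its terms is dense in $[0,1]$.
   Context: $\lfloor u\rfloor$ denotes the integer part of a real number $u$. *)

theory Defs
  imports "HOL-Analysis.Analysis" "HOL-Number_Theory.Totient"
begin

definition totient_ratio_sum :: "real \<Rightarrow> nat \<Rightarrow> real" where
  "totient_ratio_sum c n =
     (\<Sum>m = 1..n. real (totient (nat \<lfloor>real m powr c\<rfloor>)) / real_of_int \<lfloor>real m powr c\<rfloor>)"

definition dense_mod_1 :: "(nat \<Rightarrow> real) \<Rightarrow> bool" where
  "dense_mod_1 x \<longleftrightarrow> closure {frac (x n) | n. n \<ge> 1} = {0..1}"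

end

theory Submission
  imports Defs "HOL-Real_Asymp.Real_Asymp"
begin

text \<open>
  It suffices to find, for every \<open>\<epsilon> > 0\<close>, a block of consecutive indices \<open>m\<close> on which
  \<open>\<phi>(N)/N\<close> with \<open>N = \<lfloor>m\<^sup>c\<rfloor>\<close> stays below \<open>\<epsilon>\<close> but sums up to at least \<open>1\<close>.

  If \<open>c\<close> is not an integer, fix \<open>q\<close> with \<open>\<phi>(q)/q < \<epsilon>\<close> and let \<open>r = \<lfloor>c\<rfloor>\<close>. The \<open>r\<close>-th finite
  difference of \<open>m\<^sup>c/q\<close> tends to infinity, but so slowly that modulo 1 it stays in a tiny interval
  to the right of \<open>0\<close> for a long time. Meanwhile the difference of order \<open>r - 1\<close> moves modulo 1
  by tiny positive steps, so it too enters a (larger) tiny interval and stays there; descending to order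
  \<open>0\<close> gives a block around \<open>M\<close>, longer than any given multiple of \<open>log M\<close>, on which the fractional
  part of \<open>m\<^sup>c/q\<close> is below \<open>1/q\<close>, that is, \<open>q\<close> divides \<open>\<lfloor>m\<^sup>c\<rfloor>\<close>. The trivial bound
  \<open>\<phi>(N)/N \<ge> 1/(1 + log\<^sub>2 N)\<close> then makes the sum at least \<open>1\<close>.

  If \<open>c\<close> is an integer, then \<open>\<phi>(m\<^sup>c)/m\<^sup>c = \<phi>(m)/m\<close>. Choose \<open>K\<close> disjoint sets of primes above \<open>K\<close>, each
  with Euler product between \<open>\<epsilon>/2\<close> and \<open>\<epsilon>\<close>. By the Chinese remainder theorem there is an arithmetic
  progression of \<open>a\<close> such that the primes of the \<open>j\<close>-th set divide \<open>a + j\<close> for all \<open>j \<le> K\<close>. On average over the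
  progression the remaining prime factors \<open>p\<close> of \<open>a + j\<close> satisfy \<open>\<Sum>1/p \<le> 2\<close>, hence for some \<open>a\<close>
  the block has sum at least \<open>K \<epsilon> e\<^sup>-\<^sup>4 / 2\<close>.
\<close>

section \<open>Small steps modulo 1\<close>

text \<open>A discrete intermediate value theorem: the first index at which \<open>h\<close> reaches
  \<open>t\<close> overshoots by at most one step. Downward jumps of \<open>h\<close> are
  harmless.\<close>

lemma ex_crossing:
  fixes h :: "nat \<Rightarrow> real"
  assumes "a \<le> b" "h a \<le> t" "t \<le> h b" "\<epsilon> \<ge> 0"
    and step: "\<And>n. n \<in> {a..<b} \<Longrightarrow> h (Suc n) \<le> h n + \<epsilon>"
  shows "\<exists>n\<in>{a..b}. t \<le> h n \<and> h n \<le> t + \<epsilon>"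
proof -
  define n where "n = (LEAST n. a \<le> n \<and> t \<le> h n)"
  have n: "a \<le> n \<and> t \<le> h n"
    unfolding n_def by (rule LeastI[of _ b]) (use assms in simp)
  have nb: "n \<le> b"
    unfolding n_def by (rule Least_le) (use assms in simp)
  have "h n \<le> t + \<epsilon>"
  proof (cases "n = a")
    case True
    then show ?thesis using assms by simp
  next
    case False
    then obtain k where k: "n = Suc k" "a \<le> k"
      using n by (cases n) auto
    have "\<not> (a \<le> k \<and> t \<le> h k)"
      using k not_less_Least[of k "\<lambda>n. a \<le> n \<and> t \<le> h n"] unfolding n_def by simp
    then show ?thesis
      using step[of k] k nb by auto
  qed
  then show ?thesis using n nb by auto
qed

text \<open>A run that gains at least 1 passes some integer translate of every \<open>y\<close>, and
  small upward steps force it to land just above that translate.\<close>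

lemma dense_mod_1_if_small_step_runs:
  fixes x :: "nat \<Rightarrow> real"
  assumes runs: "\<And>\<epsilon>. \<epsilon> > 0 \<Longrightarrow>
    \<exists>a b. 1 \<le> a \<and> a \<le> b \<and> x a + 1 \<le> x b \<and> (\<forall>n\<in>{a..<b}. x (Suc n) \<le> x n + \<epsilon>)"
  shows "dense_mod_1 x"
proof -
  let ?S = "{frac (x n) | n. n \<ge> 1}"
  have "?S \<subseteq> {0..1}"
    by (auto simp: frac_lt_1 less_imp_le)
  then have sub: "closure ?S \<subseteq> {0..1}"
    by (intro closure_minimal) auto
  have "{0<..<1} \<subseteq> closure ?S"
  proof
    fix y :: real assume y: "y \<in> {0<..<1}"
    have "\<exists>z\<in>?S. dist z y < e" if "e > 0" for e
    proof -
      \<comment> \<open>The bound by \<open>1 - y\<close> keeps \<open>y + \<epsilon>\<close> below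
        1, so that landing above \<open>y\<close> does not wrap around modulo 1.\<close>
      define \<epsilon> where "\<epsilon> = min e (1 - y) / 2"
      have \<epsilon>: "\<epsilon> > 0" "\<epsilon> < e" "y + \<epsilon> < 1"
        using y that by (auto simp: \<epsilon>_def min_def field_simps)
      obtain a b where ab: "1 \<le> a" "a \<le> b" "x a + 1 \<le> x b"
        "\<And>n. n \<in> {a..<b} \<Longrightarrow> x (Suc n) \<le> x n + \<epsilon>"
        using runs[OF \<epsilon>(1)] by blast
      \<comment> \<open>The least integer translate of \<open>y\<close> that is at least
        \<open>x a\<close>; it is less than \<open>x a + 1\<close>, hence less than
        \<open>x b\<close>.\<close>
      define t where "t = of_int \<lceil>x a - y\<rceil> + y"
      have "x a \<le> t" "t \<le> x b"
        using ab(3) unfolding t_def by linarith+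
      then obtain n where n: "n \<in> {a..b}" "t \<le> x n" "x n \<le> t + \<epsilon>"
        using ex_crossing[of a b x t \<epsilon>] ab \<epsilon> by auto
      have "frac (x n) = x n - of_int \<lceil>x a - y\<rceil>"
        using n y \<epsilon> by (subst frac_unique_iff) (auto simp: t_def)
      then have "dist (frac (x n)) y < e"
        using n \<epsilon> by (auto simp: t_def dist_real_def)
      moreover have "n \<ge> 1"
        using n(1) ab(1) by simp
      ultimately show ?thesis
        by blast
    qed
    then show "y \<in> closure ?S"
      by (auto simp: closure_approachable)
  qed
  then have "closure {0<..<1::real} \<subseteq> closure ?S"
    by (intro closure_minimal) auto
  with sub show ?thesis
    unfolding dense_mod_1_def by auto
qed

text \<open>Once \<open>h\<close> has just crossed the level \<open>\<delta> / 2\<close> modulo 1,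
  the crossing step and \<open>N\<close> further steps together climb at most another
  \<open>\<delta> / 2\<close>. Staying above \<open>\<delta> / 2\<close>, not just above 0,
  guarantees progress when these values serve as increments of another sequence.\<close>

lemma ex_long_stay_mod_1:
  fixes h :: "nat \<Rightarrow> real"
  assumes "a \<le> b" "h a + 1 \<le> h b" "\<eta> \<ge> 0" "0 < \<delta>" "\<delta> < 1" "(real N + 1) * \<eta> \<le> \<delta> / 2"
    and step: "\<And>m. m \<in> {a..<b + N} \<Longrightarrow> h m \<le> h (Suc m) \<and> h (Suc m) \<le> h m + \<eta>"
  shows "\<exists>n\<in>{a..b}. \<forall>m\<in>{n..n + N}. frac (h m) \<in> {\<delta> / 2..\<delta>}"
proof -
  define t where "t = of_int \<lceil>h a - \<delta> / 2\<rceil> + \<delta> / 2"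
  have "h a \<le> t" "t \<le> h b"
    using assms(2) unfolding t_def by linarith+
  then obtain n where n: "n \<in> {a..b}" "t \<le> h n" "h n \<le> t + \<eta>"
    using ex_crossing[of a b h t \<eta>] assms by auto
  have stay: "t \<le> h (n + j) \<and> h (n + j) \<le> t + (real j + 1) * \<eta>" if "j \<le> N" for j
    using that
  proof (induction j)
    case 0
    then show ?case using n by simp
  next
    case (Suc j)
    then show ?case
      using step[of "n + j"] n(1) by (auto simp: algebra_simps)
  qed
  have "frac (h m) \<in> {\<delta> / 2..\<delta>}" if m: "m \<in> {n..n + N}" for m
  proof -
    define j where "j = m - n"
    have j: "m = n + j" "j \<le> N"
      using m by (auto simp: j_def)
    have "(real j + 1) * \<eta> \<le> (real N + 1) * \<eta>"
      using j assms by (intro mult_right_mono) auto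
    then have bd: "t \<le> h m" "h m \<le> t + \<delta> / 2"
      using stay[OF j(2)] j(1) assms by auto
    then have "frac (h m) = h m - of_int \<lceil>h a - \<delta> / 2\<rceil>"
      using assms by (subst frac_unique_iff) (auto simp: t_def)
    then show ?thesis
      using bd by (auto simp: t_def)
  qed
  then show ?thesis
    using n by blast
qed

text \<open>Subtracting the integer parts of all increments turns \<open>g\<close> into an
  increasing \<open>h\<close> that agrees with it modulo 1. Each step of \<open>h\<close> is between
  \<open>\<delta> / 2\<close> and \<open>\<delta>\<close>, so \<open>M\<close> steps gain 1 and
  \<open>ex_long_stay_mod_1\<close> applies.\<close>

lemma ex_long_stay_mod_1_of_diff:
  fixes g :: "nat \<Rightarrow> real"
  assumes "0 < \<delta>" "0 < \<delta>'" "\<delta>' < 1" "(real N' + 1) * \<delta> \<le> \<delta>' / 2" "2 \<le> real M * \<delta>" "M + N' \<le> N"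
    and diff: "\<And>m. m \<in> {a..a + N} \<Longrightarrow> frac (g (Suc m) - g m) \<in> {\<delta> / 2..\<delta>}"
  shows "\<exists>b. a \<le> b \<and> b + N' \<le> a + N \<and> (\<forall>m\<in>{b..b + N'}. frac (g m) \<in> {\<delta>' / 2..\<delta>'})"
proof -
  define h where "h m = g m - of_int (\<Sum>i = a..<m. \<lfloor>g (Suc i) - g i\<rfloor>)" for m
  have h_Suc: "h (Suc m) = h m + frac (g (Suc m) - g m)" if "m \<ge> a" for m
    using that by (simp add: h_def frac_def)
  have grow: "h a + real j * (\<delta> / 2) \<le> h (a + j)" if "j \<le> N" for j
    using that
  proof (induction j)
    case (Suc j)
    then show ?case
      using h_Suc[of "a + j"] diff[of "a + j"] by (simp add: field_simps)
  qed simp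
  have "h a + 1 \<le> h (a + M)"
    using grow[of M] assms by auto
  moreover have "h m \<le> h (Suc m) \<and> h (Suc m) \<le> h m + \<delta>" if "m \<in> {a..<a + M + N'}" for m
    using that h_Suc[of m] diff[of m] assms by (auto simp: frac_ge_0)
  ultimately obtain n where n: "n \<in> {a..a + M}" "\<forall>m\<in>{n..n + N'}. frac (h m) \<in> {\<delta>' / 2..\<delta>'}"
    using ex_long_stay_mod_1[of a "a + M" h \<delta> \<delta>' N'] assms by auto
  have "frac (h m) = frac (g m)" for m
    unfolding h_def by (simp add: frac_def del: of_int_sum)
  then show ?thesis
    using n assms by (intro exI[of _ n]) auto
qed

section \<open>Euler products and the totient ratio\<close>

definition euler_prod :: "nat set \<Rightarrow> real" where
  "euler_prod A = (\<Prod>p\<in>A. 1 - 1 / real p)"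

definition totient_ratio :: "nat \<Rightarrow> real" where
  "totient_ratio n = real (totient n) / real n"

lemma totient_ratio_eq_euler_prod: "n > 0 \<Longrightarrow> totient_ratio n = euler_prod (prime_factors n)"
  unfolding totient_ratio_def euler_prod_def using totient_formula2[of n] by simp

lemma totient_ratio_power: "k > 0 \<Longrightarrow> totient_ratio (n ^ k) = totient_ratio n"
  unfolding totient_ratio_def by (cases k) (simp_all add: totient_power_Suc del: power_Suc, simp)

lemma euler_prod_pos: "(\<And>p. p \<in> A \<Longrightarrow> p \<ge> 2) \<Longrightarrow> euler_prod A > 0"
  unfolding euler_prod_def by (rule prod_pos) force

lemma euler_prod_antimono:
  assumes "finite B" "A \<subseteq> B" "\<And>p. p \<in> B \<Longrightarrow> p \<ge> 2"
  shows "euler_prod B \<le> euler_prod A"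
proof -
  have "euler_prod B = euler_prod (B - A) * euler_prod A"
    unfolding euler_prod_def using assms by (intro prod.subset_diff) auto
  moreover have "euler_prod (B - A) \<le> 1"
    unfolding euler_prod_def using assms by (intro prod_le_1) force
  moreover have "euler_prod A > 0"
    using assms by (intro euler_prod_pos) auto
  ultimately show ?thesis
    by (simp add: mult_le_cancel_right1)
qed

lemma totient_ratio_dvd_mono:
  assumes "a dvd b" "b > 0"
  shows "totient_ratio b \<le> totient_ratio a"
proof -
  have "a > 0"
    using assms by (auto intro: Nat.gr0I)
  then show ?thesis
    using assms dvd_prime_factors[of b a]
    by (auto simp: totient_ratio_eq_euler_prod prime_ge_2_nat in_prime_factors_iff intro!: euler_prod_antimono)
qed

text \<open>The extreme case is the set of the first \<open>card A\<close> integers from 2 on, where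
  the product telescopes. The induction adds the largest element, which is at least
  \<open>card A + 2\<close>.\<close>

lemma euler_prod_ge_card:
  assumes "finite A" "\<And>p. p \<in> A \<Longrightarrow> p \<ge> 2"
  shows "euler_prod A \<ge> 1 / (real (card A) + 1)"
  using assms
proof (induction A rule: finite_linorder_max_induct)
  case empty
  then show ?case by (simp add: euler_prod_def)
next
  case (insert b A)
  have "A \<subseteq> {2..<b}"
    using insert by auto
  then have "card A \<le> b - 2"
    using card_mono[of "{2..<b}" A] by simp
  then have b: "real b \<ge> real (card A) + 2"
    using insert.prems[of b] by auto
  have "1 / (real (card A) + 2) = (1 - 1 / (real (card A) + 2)) * (1 / (real (card A) + 1))"
    by (simp add: field_simps)
  also have "\<dots> \<le> (1 - 1 / real b) * euler_prod A"
    using insert b by (intro mult_mono diff_mono divide_left_mono) auto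
  also have "\<dots> = euler_prod (insert b A)"
    using insert by (subst (2) euler_prod_def, subst prod.insert) (auto simp: euler_prod_def)
  also have "real (card A) + 2 = real (card (insert b A)) + 1"
    using insert by (subst card_insert_disjoint) auto
  finally show ?case .
qed

lemma two_power_card_prime_factors_le: "n > 0 \<Longrightarrow> 2 ^ card (prime_factors n) \<le> (n :: nat)"
proof -
  assume n: "n > 0"
  have "2 ^ card (prime_factors n) = (\<Prod>p\<in>prime_factors n. 2::nat)"
    by simp
  also have "\<dots> \<le> (\<Prod>p\<in>prime_factors n. p)"
    by (intro prod_mono) (auto simp: in_prime_factors_iff prime_ge_2_nat)
  also have "\<dots> \<le> (\<Prod>p\<in>prime_factors n. p ^ multiplicity p n)"
    by (intro prod_mono) (auto intro!: self_le_power simp: prime_factors_multiplicity prime_gt_0_nat Suc_leI)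
  also have "\<dots> = n"
    using n by (metis prime_factorization_nat)
  finally show ?thesis .
qed

lemma totient_ratio_ge_log:
  assumes "n > 0"
  shows "totient_ratio n \<ge> 1 / (log 2 (real n) + 1)"
proof -
  have "real (card (prime_factors n)) \<le> log 2 (real n)"
    using two_power_card_prime_factors_le[OF assms] assms by (simp add: le_log_of_power)
  then have "1 / (log 2 (real n) + 1) \<le> 1 / (real (card (prime_factors n)) + 1)"
    by (intro divide_left_mono) auto
  also have "\<dots> \<le> totient_ratio n"
    unfolding totient_ratio_eq_euler_prod[OF assms]
    by (rule euler_prod_ge_card) (auto simp: in_prime_factors_iff prime_ge_2_nat)
  finally show ?thesis .
qed

section \<open>Reciprocal divisor sums against Euler products\<close>

lemma sum_inverse_divisors_mult_le:
  fixes a b :: nat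
  assumes "a > 0" "b > 0"
  shows "(\<Sum>d | d dvd a * b. 1 / real d) \<le> (\<Sum>d | d dvd a. 1 / real d) * (\<Sum>d | d dvd b. 1 / real d)"
proof -
  have "{d. d dvd a * b} \<subseteq> (\<lambda>(x, y). x * y) ` ({d. d dvd a} \<times> {d. d dvd b})"
  proof
    fix d assume "d \<in> {d. d dvd a * b}"
    then obtain x y where "d = x * y" "x dvd a" "y dvd b"
      using division_decomp[of d a b] by auto
    then show "d \<in> (\<lambda>(x, y). x * y) ` ({d. d dvd a} \<times> {d. d dvd b})"
      by force
  qed
  then have "(\<Sum>d | d dvd a * b. 1 / real d)
      \<le> sum (\<lambda>d. 1 / real d) ((\<lambda>(x, y). x * y) ` ({d. d dvd a} \<times> {d. d dvd b}))"
    using assms by (intro sum_mono2) auto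
  also have "\<dots> \<le> sum ((\<lambda>d. 1 / real d) \<circ> (\<lambda>(x, y). x * y)) ({d. d dvd a} \<times> {d. d dvd b})"
    using assms by (intro sum_image_le) auto
  also have "\<dots> = (\<Sum>d | d dvd a. 1 / real d) * (\<Sum>d | d dvd b. 1 / real d)"
    by (simp add: sum_product sum.cartesian_product case_prod_unfold)
  finally show ?thesis .
qed

lemma sum_inverse_divisors_prime_power_le:
  fixes p :: nat
  assumes "prime p"
  shows "(\<Sum>d | d dvd p ^ k. 1 / real d) \<le> 1 / (1 - 1 / real p)"
proof -
  have p: "p \<ge> 2"
    using assms by (rule prime_ge_2_nat)
  have "{d. d dvd p ^ k} = (\<lambda>i. p ^ i) ` {..k}"
    using divides_primepow_nat[OF assms] by auto
  moreover have "inj_on (\<lambda>i. p ^ i) {..k}"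
    using p by (auto intro!: inj_onI)
  ultimately have "(\<Sum>d | d dvd p ^ k. 1 / real d) = (\<Sum>i\<le>k. (1 / real p) ^ i)"
    by (simp add: sum.reindex power_one_over)
  also have "\<dots> = (1 - (1 / real p) ^ Suc k) / (1 - 1 / real p)"
    using p by (simp add: sum_gp0)
  also have "\<dots> \<le> 1 / (1 - 1 / real p)"
    using p by (intro divide_right_mono) auto
  finally show ?thesis .
qed

text \<open>Submultiplicativity splits the divisor sum into prime powers, each giving a truncated
  geometric series. This half of the Euler product formula transfers the divergence of the harmonic
  series to \<open>euler_prod\<close>.\<close>

lemma sum_inverse_divisors_prod_le:
  fixes f :: "nat \<Rightarrow> nat"
  assumes "finite A" "\<And>p. p \<in> A \<Longrightarrow> prime p"
  shows "(\<Sum>d | d dvd (\<Prod>p\<in>A. p ^ f p). 1 / real d) \<le> 1 / euler_prod A"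
  using assms
proof (induction A)
  case empty
  then show ?case by (simp add: euler_prod_def)
next
  case (insert p A)
  have pos: "(\<Prod>p\<in>A. p ^ f p) > 0"
    using insert by (intro prod_pos) (auto simp: prime_gt_0_nat)
  have "(\<Sum>d | d dvd (\<Prod>p\<in>insert p A. p ^ f p). 1 / real d)
      \<le> (\<Sum>d | d dvd p ^ f p. 1 / real d) * (\<Sum>d | d dvd (\<Prod>p\<in>A. p ^ f p). 1 / real d)"
    using insert pos by (simp add: sum_inverse_divisors_mult_le prime_gt_0_nat)
  also have "\<dots> \<le> 1 / (1 - 1 / real p) * (1 / euler_prod A)"
    using insert prime_gt_1_nat[of p]
    by (intro mult_mono sum_inverse_divisors_prime_power_le insert.IH) (auto intro!: sum_nonneg)
  also have "\<dots> = 1 / euler_prod (insert p A)"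
    using insert by (simp add: euler_prod_def)
  finally show ?case .
qed

text \<open>All of \<open>1, ..., n\<close> divide \<open>fact n\<close>, so the reciprocal of its
  totient ratio is at least \<open>harm n\<close>, which is unbounded.\<close>

lemma ex_totient_ratio_less:
  assumes "\<epsilon> > 0"
  shows "\<exists>n>0. totient_ratio n < \<epsilon>"
proof -
  have "eventually (\<lambda>n. harm n > 1 / \<epsilon>) sequentially"
    using harm_at_top by (simp add: filterlim_at_top_dense)
  then obtain n where n: "harm n > 1 / \<epsilon>"
    by (auto simp: eventually_sequentially)
  define N :: nat where "N = fact n"
  have N: "N > 0"
    by (simp add: N_def)
  have "harm n = (\<Sum>d\<in>{1..n}. 1 / real d)"
    by (simp add: harm_def inverse_eq_divide)
  also have "\<dots> \<le> (\<Sum>d | d dvd N. 1 / real d)"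
    using N by (intro sum_mono2) (auto simp: N_def dvd_fact)
  also have "\<dots> = (\<Sum>d | d dvd (\<Prod>p\<in>prime_factors N. p ^ multiplicity p N). 1 / real d)"
    using N prime_factorization_nat[of N] by simp
  also have "\<dots> \<le> 1 / euler_prod (prime_factors N)"
    by (rule sum_inverse_divisors_prod_le) auto
  finally have "1 / \<epsilon> < 1 / totient_ratio N"
    using n N by (simp add: totient_ratio_eq_euler_prod)
  moreover have "totient_ratio N > 0"
    using N by (simp add: totient_ratio_def)
  ultimately show ?thesis
    using N assms by (auto simp: field_simps)
qed

section \<open>Non-integer exponents\<close>

definition fdiff :: "(real \<Rightarrow> real) \<Rightarrow> real \<Rightarrow> real" where
  "fdiff f x = f (x + 1) - f x"

text \<open>\<open>F\<close> lists the successive derivatives of \<open>F 0\<close>. Differencing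
  every member gives such a family again, so the induction hypothesis applies to it, and one
  ordinary mean value step finishes.\<close>

lemma fdiff_funpow_mean_value:
  fixes F :: "nat \<Rightarrow> real \<Rightarrow> real"
  assumes "\<And>k x. x > 0 \<Longrightarrow> (F k has_real_derivative F (Suc k) x) (at x)" "a > 0"
  shows "\<exists>\<xi>\<in>{a..a + real n}. (fdiff ^^ n) (F 0) a = F n \<xi>"
  using assms
proof (induction n arbitrary: F)
  case 0
  then show ?case by simp
next
  case (Suc n)
  have "(fdiff (F k) has_real_derivative fdiff (F (Suc k)) x) (at x)" if "x > 0" for k x
  proof -
    have "((\<lambda>x. F k (x + 1)) has_real_derivative F (Suc k) (x + 1)) (at x)"
      using Suc.prems(1)[of "x + 1" k] that by (simp add: DERIV_shift)
    then show ?thesis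
      using Suc.prems(1)[OF that, of k] unfolding fdiff_def by (rule DERIV_diff)
  qed
  then obtain \<xi> where \<xi>: "\<xi> \<in> {a..a + real n}" "(fdiff ^^ n) (fdiff (F 0)) a = fdiff (F n) \<xi>"
    using Suc.IH[of "\<lambda>k. fdiff (F k)"] Suc.prems(2) by blast
  obtain z where "\<xi> < z" "z < \<xi> + 1" "F n (\<xi> + 1) - F n \<xi> = (\<xi> + 1 - \<xi>) * F (Suc n) z"
    using MVT2[of \<xi> "\<xi> + 1" "F n" "F (Suc n)"] Suc.prems \<xi>(1) by force
  then have "z \<in> {a..a + real (Suc n)}" "fdiff (F n) \<xi> = F (Suc n) z"
    using \<xi>(1) by (auto simp: fdiff_def)
  then show ?case
    using \<xi>(2) by (intro bexI[of _ z]) (simp_all add: funpow_Suc_right del: funpow.simps)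
qed

text \<open>Each induction step lowers the order of the difference by one through
  \<open>ex_long_stay_mod_1_of_diff\<close>. The exponent \<open>d\<close> depends on
  \<open>r\<close> alone, so the required window is only a fixed power of \<open>T\<close>.\<close>

lemma ex_run_of_fdiff_funpow:
  "\<exists>d\<ge>1. \<forall>T\<ge>5. \<forall>f a. (\<forall>m\<in>{a..a + T ^ (d + 1)}.
       frac ((fdiff ^^ r) f (real m)) \<in> {1 / real T ^ d / 2..1 / real T ^ d}) \<longrightarrow>
     (\<exists>b\<ge>a. b + T \<le> a + T ^ (d + 1) \<and> (\<forall>m\<in>{b..b + T}. frac (f (real m)) \<le> 1 / real T))"
proof (induction r)
  case 0
  have "\<exists>b\<ge>a. b + T \<le> a + T ^ (1 + 1) \<and> (\<forall>m\<in>{b..b + T}. frac (f (real m)) \<le> 1 / real T)"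
    if T: "T \<ge> 5" and fr: "\<forall>m\<in>{a..a + T ^ (1 + 1)}.
       frac ((fdiff ^^ 0) f (real m)) \<in> {1 / real T ^ 1 / 2..1 / real T ^ 1}" for T :: nat and f a
  proof -
    have "T \<le> T ^ (1 + 1)"
      using T by simp
    moreover have "frac (f (real m)) \<le> 1 / real T" if "m \<in> {a..a + T}" for m
    proof -
      have "m \<in> {a..a + T ^ (1 + 1)}"
        using that \<open>T \<le> T ^ (1 + 1)\<close> unfolding atLeastAtMost_iff by linarith
      from bspec[OF fr this] show ?thesis by simp
    qed
    ultimately show ?thesis
      by (intro exI[of _ a]) auto
  qed
  then show ?case
    by (intro exI[of _ 1]) blast
next
  case (Suc r)
  then obtain d where d: "d \<ge> 1" and IH: "\<And>(T::nat) f a. T \<ge> 5 \<Longrightarrow>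
      \<forall>m\<in>{a..a + T ^ (d + 1)}. frac ((fdiff ^^ r) f (real m)) \<in> {1 / real T ^ d / 2..1 / real T ^ d} \<Longrightarrow>
      \<exists>b\<ge>a. b + T \<le> a + T ^ (d + 1) \<and> (\<forall>m\<in>{b..b + T}. frac (f (real m)) \<le> 1 / real T)"
    by blast
  \<comment> \<open>A stay of \<open>T ^ (d + 1)\<close> steps of size \<open>T ^ -e\<close> within
    an interval of length about \<open>T ^ -d\<close> needs \<open>e\<close> to be at least
    \<open>2 * d + 1\<close>; one more factor \<open>T\<close> absorbs the constants.\<close>
  define e where "e = 2 * d + 2"
  have "\<exists>b\<ge>a. b + T \<le> a + T ^ (e + 1) \<and> (\<forall>m\<in>{b..b + T}. frac (f (real m)) \<le> 1 / real T)"
    if T: "T \<ge> 5" and fr: "\<forall>m\<in>{a..a + T ^ (e + 1)}.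
       frac ((fdiff ^^ Suc r) f (real m)) \<in> {1 / real T ^ e / 2..1 / real T ^ e}" for T :: nat and f a
  proof -
    have Td: "real T ^ d \<ge> 5"
    proof -
      have "5 \<le> real T ^ 1"
        using T by simp
      also have "\<dots> \<le> real T ^ d"
        using T d by (intro power_increasing) auto
      finally show ?thesis .
    qed
    define u where "u = real T ^ d"
    have u: "u \<ge> 5" "real T ^ (d + 1) = real T * u" "real T ^ e = real T ^ 2 * u ^ 2"
      using Td by (auto simp: u_def e_def power_add mult_2 power2_eq_square)
    have Tu: "real T * u \<ge> 5 * 1"
      using T u(1) by (intro mult_mono) auto
    have "2 * (real T * u + 1) * u \<le> 4 * (real T * u) * u"
      using Tu u(1) by (intro mult_right_mono) (auto simp: mult.commute)
    also have "\<dots> \<le> real T * (real T * u) * u"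
      using T u(1) by (intro mult_right_mono) auto
    finally have 1: "2 * (real T * u + 1) * u \<le> real T ^ 2 * u ^ 2"
      by (simp add: power2_eq_square mult_ac)
    have "(real (T ^ (d + 1)) + 1) * (1 / real T ^ e) \<le> 1 / real T ^ d / 2"
      using 1 T u unfolding of_nat_power u u_def[symmetric] by (simp add: field_simps)
    moreover have "2 \<le> real (2 * T ^ e) * (1 / real T ^ e)"
      using T by simp
    \<comment> \<open>The first \<open>2 * T ^ e\<close> steps suffice to gain 1; the rest of the
      window leaves room for the stay.\<close>
    moreover have "2 * T ^ e + T ^ (d + 1) \<le> T ^ (e + 1)"
    proof -
      have "T ^ (d + 1) \<le> T ^ e"
        using T by (intro power_increasing) (auto simp: e_def)
      moreover have "3 * T ^ e \<le> T * T ^ e"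
        using T by (intro mult_right_mono) auto
      ultimately show ?thesis
        unfolding Suc_eq_plus1[symmetric] power_Suc[of T e] by linarith
    qed
    moreover have "frac ((fdiff ^^ r) f (real (Suc m)) - (fdiff ^^ r) f (real m)) \<in> {1 / real T ^ e / 2..1 / real T ^ e}"
      if "m \<in> {a..a + T ^ (e + 1)}" for m
      using fr that by (simp add: fdiff_def add.commute)
    ultimately obtain b where b: "a \<le> b" "b + T ^ (d + 1) \<le> a + T ^ (e + 1)"
      "\<forall>m\<in>{b..b + T ^ (d + 1)}. frac ((fdiff ^^ r) f (real m)) \<in> {1 / real T ^ d / 2..1 / real T ^ d}"
      using ex_long_stay_mod_1_of_diff[of "1 / real T ^ e" "1 / real T ^ d" "T ^ (d + 1)" "2 * T ^ e"
          "T ^ (e + 1)" a "\<lambda>m. (fdiff ^^ r) f (real m)"] T Td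
      by auto
    from IH[OF T b(3)] b(1,2) show ?thesis
      by (meson order_trans)
  qed
  then show ?case
    by (intro exI[of _ e]) (auto simp: e_def)
qed

lemma dvd_nat_floor_if_frac_less:
  assumes "x \<ge> 0" "q > 0" "frac (x / real q) < 1 / real q"
  shows "q dvd nat \<lfloor>x\<rfloor>"
proof -
  define k where "k = \<lfloor>x / real q\<rfloor>"
  have "x = real q * k + real q * frac (x / real q)"
    using assms by (simp add: frac_def k_def field_simps)
  moreover have "0 \<le> real q * frac (x / real q)" "real q * frac (x / real q) < 1"
    using assms by (auto simp: field_simps)
  ultimately have "real q * k \<le> x" "x < real q * k + 1"
    by linarith+
  then have "\<lfloor>x\<rfloor> = int q * k"
    by (auto simp: floor_eq_iff)
  then show ?thesis
    using assms by (simp add: nat_mult_distrib)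
qed

section \<open>Choice of scale and long runs of divisible values\<close>

lemma eventually_poly_le_exp:
  fixes A b :: real
  assumes "b > 0"
  shows "eventually (\<lambda>k::nat. A * real k ^ e \<le> (2 ^ k) powr b) sequentially"
  using assms by real_asymp

text \<open>Ensures that the \<open>r\<close>-th difference, of size about
  \<open>C * x powr s\<close>, gains 1 between \<open>2 ^ k\<close> and its square.\<close>

lemma eventually_powr_gap:
  fixes C s \<rho> :: real
  assumes "C > 0" "s > 0" "\<rho> \<ge> 0"
  shows "eventually (\<lambda>k::nat. C * (2 ^ k + \<rho>) powr s + 1 \<le> C * ((2 ^ k) ^ 2) powr s) sequentially"
  using assms by real_asymp

lemma ex_long_divisible_run:
  fixes c :: real
  assumes c: "c > 1" "c \<notin> \<int>" and q: "q > 0"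
  shows "\<exists>b T. 1 \<le> b \<and> 1 + c * log 2 (real (b + T)) \<le> real T \<and>
           (\<forall>m\<in>{b..b + T}. q dvd nat \<lfloor>real m powr c\<rfloor>)"
proof -
  define r where "r = nat \<lfloor>c\<rfloor>"
  define s where "s = c - real r"
  have r_eq: "real r = of_int \<lfloor>c\<rfloor>"
    using c by (simp add: r_def)
  have "real r \<noteq> c"
    using c(2) by auto
  then have s: "0 < s" "s < 1"
    unfolding s_def r_eq by linarith+
  \<comment> \<open>The \<open>k\<close>-th derivative of \<open>x powr c / q\<close>. At order
    \<open>r\<close> the exponent is \<open>s\<close>, strictly between 0 and 1, so
    \<open>F r\<close> is unbounded while its derivative tends to 0.\<close>
  define F where "F k x = (\<Prod>i<k. c - real i) * x powr (c - real k) / real q" for k x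
  have F_deriv: "(F k has_real_derivative F (Suc k) x) (at x)" if "x > 0" for k x
    unfolding F_def using that q
    by (auto intro!: derivative_eq_intros simp: algebra_simps diff_divide_distrib)
  define C where "C = (\<Prod>i<r. c - real i) / real q"
  have "C > 0"
    unfolding C_def using q s by (intro divide_pos_pos prod_pos) (auto simp: s_def)
  have F_r: "F r x = C * x powr s" and F_Suc_r: "F (Suc r) x = C * s * x powr (s - 1)" for x
    by (simp_all add: F_def C_def s_def algebra_simps)
  define g where "g m = (fdiff ^^ r) (F 0) (real m)" for m :: nat
  have g_bounds: "C * real m powr s \<le> g m \<and> g m \<le> C * (real m + real r) powr s" if "m > 0" for m
  proof -
    obtain \<xi> where "\<xi> \<in> {real m..real m + real r}" "g m = F r \<xi>"
      using fdiff_funpow_mean_value[of F "real m" r] F_deriv \<open>m > 0\<close> by (auto simp: g_def)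
    then show ?thesis
      using \<open>C > 0\<close> s \<open>m > 0\<close> unfolding F_r by (auto intro!: mult_left_mono powr_mono2)
  qed
  \<comment> \<open>The step is a value of \<open>F (Suc r)\<close>, which is positive and, since
    \<open>s < 1\<close>, decreasing; one bound at \<open>a\<close> therefore serves all later
    indices.\<close>
  have g_step: "g m \<le> g (Suc m) \<and> g (Suc m) \<le> g m + C * s * real a powr (s - 1)"
    if "a > 0" "m \<ge> a" for m a
  proof -
    have "m > 0"
      using that by simp
    then obtain \<xi> where \<xi>: "\<xi> \<in> {real m..real m + real (Suc r)}" "(fdiff ^^ Suc r) (F 0) (real m) = F (Suc r) \<xi>"
      using fdiff_funpow_mean_value[where F = F and a = "real m" and n = "Suc r", OF F_deriv] \<open>m > 0\<close>
      by (metis of_nat_0_less_iff)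
    then have "g (Suc m) - g m = C * s * \<xi> powr (s - 1)"
      unfolding F_Suc_r by (simp add: g_def fdiff_def add.commute)
    moreover have "\<xi> powr (s - 1) \<le> real a powr (s - 1)"
      using \<xi> that s by (intro powr_mono2') auto
    then have "C * s * \<xi> powr (s - 1) \<le> C * s * real a powr (s - 1)"
      using \<open>C > 0\<close> s by (intro mult_left_mono) auto
    moreover have "C * s * \<xi> powr (s - 1) \<ge> 0"
      using \<open>C > 0\<close> s by simp
    ultimately show ?thesis by linarith
  qed
  obtain d where d: "d \<ge> 1" and run: "\<And>(T::nat) a. T \<ge> 5 \<Longrightarrow>
      \<forall>m\<in>{a..a + T ^ (d + 1)}. frac (g m) \<in> {1 / real T ^ d / 2..1 / real T ^ d} \<Longrightarrow>
      \<exists>b\<ge>a. b + T \<le> a + T ^ (d + 1) \<and> (\<forall>m\<in>{b..b + T}. frac (F 0 (real m)) \<le> 1 / real T)"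
    using ex_run_of_fdiff_funpow[of r] unfolding g_def by metis
  \<comment> \<open>The run will end by \<open>2 ^ (3 * k)\<close>, so its length
    \<open>T = K * k\<close> must be at least \<open>1 + 3 * c * k\<close>.\<close>
  define K where "K = nat \<lceil>3 * c\<rceil> + 1"
  have K: "real K \<ge> 3 * c + 1"
    unfolding K_def using c by linarith
  \<comment> \<open>With \<open>a0 = 2 ^ k\<close> and \<open>N = T ^ (d + 1)\<close>, the four
    conditions say that \<open>g\<close> gains 1 between \<open>a0\<close> and
    \<open>a0 ^ 2\<close>, that \<open>N + 1\<close> steps move \<open>g\<close> by at most half of
    \<open>1 / T ^ d\<close>, that \<open>N \<le> a0\<close>, and that \<open>T\<close> exceeds both
    4 and \<open>q\<close>.\<close>
  have "\<forall>\<^sub>F k in sequentially. C * (2 ^ k + real r) powr s + 1 \<le> C * ((2 ^ k) ^ 2) powr s"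
    using eventually_powr_gap[of C s "real r"] \<open>C > 0\<close> s by simp
  moreover have "\<forall>\<^sub>F k in sequentially. 4 * C * s * real K ^ (2 * d + 1) * real k ^ (2 * d + 1) \<le> (2 ^ k) powr (1 - s)"
    by (rule eventually_poly_le_exp) (use s in simp)
  moreover have "\<forall>\<^sub>F k in sequentially. real K ^ (d + 1) * real k ^ (d + 1) \<le> (2 ^ k) powr 1"
    by (rule eventually_poly_le_exp) simp
  moreover have "\<forall>\<^sub>F k in sequentially. k \<ge> max 5 q"
    by (rule eventually_ge_at_top)
  ultimately have "\<forall>\<^sub>F k in sequentially.
     C * (2 ^ k + real r) powr s + 1 \<le> C * ((2 ^ k) ^ 2) powr s \<and>
     4 * C * s * real K ^ (2 * d + 1) * real k ^ (2 * d + 1) \<le> (2 ^ k) powr (1 - s) \<and>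
     real K ^ (d + 1) * real k ^ (d + 1) \<le> (2 ^ k) powr 1 \<and> k \<ge> max 5 q"
    by eventually_elim blast
  then obtain k where
    k1: "C * (2 ^ k + real r) powr s + 1 \<le> C * ((2 ^ k) ^ 2) powr s" and
    k2: "4 * C * s * real K ^ (2 * d + 1) * real k ^ (2 * d + 1) \<le> (2 ^ k) powr (1 - s)" and
    k3: "real K ^ (d + 1) * real k ^ (d + 1) \<le> (2 ^ k) powr 1" and
    k4: "k \<ge> 5" "k \<ge> q"
    by (auto simp: eventually_sequentially)
  define T where "T = K * k"
  define N where "N = T ^ (d + 1)"
  define a0 :: nat where "a0 = 2 ^ k"
  have "real K \<ge> 4"
    using K c by linarith
  then have "K \<ge> 4" by simp
  then have "4 * k \<le> T"
    unfolding T_def by (rule mult_right_mono) simp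
  then have T: "T \<ge> 5" "q < T"
    using k4 by auto
  have a0: "real a0 = 2 ^ k" "a0 > 0" "a0 \<ge> 2"
    using k4 self_le_power[of 2 k] by (auto simp: a0_def)
  have "real N \<le> real a0"
    using k3 by (simp add: N_def T_def a0 power_mult_distrib mult_ac)
  then have N_le: "N \<le> a0" by simp
  have "g a0 + 1 \<le> g (a0 ^ 2)"
    using k1 g_bounds[of a0] g_bounds[of "a0 ^ 2"] a0 by simp
  moreover have "(real N + 1) * (C * s * real a0 powr (s - 1)) \<le> 1 / real T ^ d / 2"
  proof -
    have "real N \<ge> 1"
      unfolding N_def of_nat_power using T by (intro one_le_power) simp
    then have "(real N + 1) * (2 * real T ^ d) * (C * s) \<le> (2 * real N) * (2 * real T ^ d) * (C * s)"
      using \<open>C > 0\<close> s by (intro mult_right_mono) auto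
    also have "\<dots> = 4 * C * s * (real K ^ (2 * d + 1) * real k ^ (2 * d + 1))"
      by (simp add: N_def T_def power_mult_distrib power_add power_mult power2_eq_square mult_ac)
    also have "\<dots> \<le> real a0 powr (1 - s)"
      using k2 by (simp add: a0 mult_ac)
    finally have "(real N + 1) * (2 * real T ^ d) * (C * s) * real a0 powr (s - 1)
        \<le> real a0 powr (1 - s) * real a0 powr (s - 1)"
      by (intro mult_right_mono) auto
    also have "\<dots> = 1"
      using a0 by (simp add: powr_add[symmetric])
    finally show ?thesis
      using T by (simp add: field_simps)
  qed
  moreover have "1 / real T ^ d < 1"
    using T d by (simp add: one_less_power)
  moreover have "C * s * real a0 powr (s - 1) \<ge> 0"
    using \<open>C > 0\<close> s by simp
  ultimately obtain n where n: "n \<in> {a0..a0 ^ 2}"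
    "\<forall>m\<in>{n..n + N}. frac (g m) \<in> {1 / real T ^ d / 2..1 / real T ^ d}"
    using ex_long_stay_mod_1[of a0 "a0 ^ 2" g "C * s * real a0 powr (s - 1)" "1 / real T ^ d" N]
      g_step[OF a0(2)] T a0 by (auto simp: self_le_power)
  obtain b where b: "n \<le> b" "b + T \<le> n + N" "\<forall>m\<in>{b..b + T}. frac (F 0 (real m)) \<le> 1 / real T"
    using run[OF T(1) n(2)[unfolded N_def]] unfolding N_def by blast
  have "b + T \<le> a0 ^ 2 + a0"
    using b n N_le by simp
  also have "\<dots> \<le> a0 ^ 2 + a0 ^ 2"
    using a0 by (intro add_left_mono self_le_power) auto
  also have "\<dots> \<le> a0 * a0 ^ 2"
    using mult_right_mono[OF a0(3), of "a0 ^ 2"] by linarith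
  also have "\<dots> = 2 ^ (3 * k)"
    by (simp add: a0_def power_mult[symmetric] power_add[symmetric] mult.commute)
  finally have "real (b + T) \<le> real (2 ^ (3 * k))"
    by (rule of_nat_mono)
  then have "log 2 (real (b + T)) \<le> log 2 (2 ^ (3 * k))"
    using T by (subst log_le_cancel_iff) auto
  then have "c * log 2 (real (b + T)) \<le> c * (3 * real k)"
    using c by (intro mult_left_mono) (auto simp: log_nat_power)
  moreover have "1 + c * (3 * real k) \<le> (3 * c + 1) * real k"
    using k4 by (simp add: algebra_simps)
  moreover have "\<dots> \<le> real T"
    unfolding T_def of_nat_mult using K by (intro mult_right_mono) auto
  ultimately have "1 + c * log 2 (real (b + T)) \<le> real T"
    by linarith
  moreover have "q dvd nat \<lfloor>real m powr c\<rfloor>" if "m \<in> {b..b + T}" for m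
  proof (rule dvd_nat_floor_if_frac_less)
    have "frac (F 0 (real m)) \<le> 1 / real T"
      using b that by blast
    also have "\<dots> < 1 / real q"
      using T q by (intro divide_strict_left_mono) auto
    finally show "frac (real m powr c / real q) < 1 / real q"
      by (simp add: F_def)
  qed (use q in auto)
  moreover have "1 \<le> b"
    using b n a0 by auto
  ultimately show ?thesis by blast
qed

section \<open>Integer exponents\<close>

lemma euler_prod_Un_disjoint:
  "finite A \<Longrightarrow> finite B \<Longrightarrow> A \<inter> B = {} \<Longrightarrow> euler_prod (A \<union> B) = euler_prod A * euler_prod B"
  unfolding euler_prod_def by (rule prod.union_disjoint)

text \<open>Primes above \<open>y\<close> are added one at a time until the product first drops
  below \<open>\<epsilon>\<close>. The last factor is at least 1/2, so the product stays at least
  \<open>\<epsilon> / 2\<close>.\<close>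

lemma ex_primes_euler_prod_between:
  assumes "0 < \<epsilon>" "\<epsilon> \<le> 1"
  shows "\<exists>A z. z \<ge> y \<and> A \<subseteq> {y<..z} \<and> (\<forall>p\<in>A. prime p) \<and> \<epsilon> / 2 \<le> euler_prod A \<and> euler_prod A < \<epsilon>"
proof -
  define P where "P n = {p. prime p \<and> y < p \<and> p \<le> n}" for n :: nat
  define B where "B = {p. prime p \<and> p \<le> y}"
  have fin: "finite (P n)" "finite B" for n
    unfolding P_def B_def by auto
  have ge2: "p \<ge> 2" if "p \<in> P n \<or> p \<in> B" for p n
    using that by (auto simp: P_def B_def prime_ge_2_nat)
  have B_pos: "euler_prod B > 0"
    using ge2 by (intro euler_prod_pos) auto
  \<comment> \<open>The factor \<open>euler_prod B\<close> compensates for the primes up to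
    \<open>y\<close>, which are left out of \<open>P N\<close>.\<close>
  obtain N where N: "N > 0" "totient_ratio N < \<epsilon> * euler_prod B"
    using ex_totient_ratio_less[of "\<epsilon> * euler_prod B"] assms B_pos by auto
  have "prime_factors N \<subseteq> B \<union> P N"
    using N by (auto simp: P_def B_def in_prime_factors_iff dvd_imp_le)
  then have "euler_prod (B \<union> P N) \<le> totient_ratio N"
    unfolding totient_ratio_eq_euler_prod[OF N(1)] using fin ge2
    by (intro euler_prod_antimono) auto
  moreover have "euler_prod (B \<union> P N) = euler_prod B * euler_prod (P N)"
    using fin by (intro euler_prod_Un_disjoint) (auto simp: P_def B_def)
  ultimately have "euler_prod B * euler_prod (P N) < euler_prod B * \<epsilon>"
    using N by (simp add: mult.commute)
  then have ex: "euler_prod (P N) < \<epsilon>"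
    using B_pos by simp
  define n where "n = (LEAST n. euler_prod (P n) < \<epsilon>)"
  have n: "euler_prod (P n) < \<epsilon>"
    unfolding n_def by (rule LeastI[of _ N]) (rule ex)
  have "P 0 = {}"
    by (auto simp: P_def)
  then have "n \<noteq> 0"
    using n assms by (metis euler_prod_def not_less prod.empty)
  then obtain k where k: "n = Suc k"
    by (cases n) auto
  have k_ge: "euler_prod (P k) \<ge> \<epsilon>"
    using not_less_Least[of k "\<lambda>n. euler_prod (P n) < \<epsilon>"] k unfolding n_def by simp
  have n_prime: "prime n \<and> y < n"
  proof (rule ccontr)
    assume "\<not> ?thesis"
    then have "P n = P k"
      unfolding P_def k by (auto simp: le_Suc_eq)
    with n k_ge show False by simp
  qed
  then have "P n = insert n (P k)"
    unfolding P_def k by (auto simp: le_Suc_eq)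
  then have "euler_prod (P n) = (1 - 1 / real n) * euler_prod (P k)"
    using fin by (simp add: euler_prod_def P_def k)
  also have "\<dots> \<ge> (1 / 2) * \<epsilon>"
  proof (rule mult_mono)
    show "1 / 2 \<le> 1 - 1 / real n"
      using n_prime prime_ge_2_nat[of n] by (simp add: field_simps)
  qed (use k_ge assms n_prime prime_ge_2_nat[of n] in auto)
  finally have "\<epsilon> / 2 \<le> euler_prod (P n)" by simp
  then show ?thesis
    using n n_prime by (intro exI[of _ "P n"] exI[of _ n]) (auto simp: P_def)
qed

text \<open>Each set is chosen above the upper end of the preceding one, starting from
  \<open>K\<close>.\<close>

lemma ex_disjoint_prime_sets:
  assumes "0 < \<epsilon>" "\<epsilon> \<le> 1"
  shows "\<exists>A :: nat \<Rightarrow> nat set. (\<forall>j. finite (A j) \<and> (\<forall>p\<in>A j. prime p \<and> K < p) \<and>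
           \<epsilon> / 2 \<le> euler_prod (A j) \<and> euler_prod (A j) < \<epsilon>) \<and> (\<forall>i j. i \<noteq> j \<longrightarrow> A i \<inter> A j = {})"
proof -
  obtain G Z where GZ: "\<And>y. Z y \<ge> (y::nat)" "\<And>y. G y \<subseteq> {y<..Z y}" "\<And>y p. p \<in> G y \<Longrightarrow> prime p"
    "\<And>y. \<epsilon> / 2 \<le> euler_prod (G y)" "\<And>y. euler_prod (G y) < \<epsilon>"
    using ex_primes_euler_prod_between[OF assms] by metis
  define Y where "Y n = (Z ^^ n) K" for n
  have mono: "Y m \<le> Y n" if "m \<le> n" for m n
    using that by (rule lift_Suc_mono_le[rotated]) (simp add: Y_def GZ)
  have sub: "G (Y n) \<subseteq> {Y n<..Y (Suc n)}" for n
    using GZ(2)[of "Y n"] by (simp add: Y_def)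
  have "G (Y i) \<inter> G (Y j) = {}" if "i < j" for i j
    using sub[of i] sub[of j] mono[of "Suc i" j] that by fastforce
  then have "G (Y i) \<inter> G (Y j) = {}" if "i \<noteq> j" for i j
    using that by (metis Int_commute linorder_neqE_nat)
  moreover have "finite (G (Y j))" for j
    using sub[of j] finite_subset by blast
  moreover have "K < p" if "p \<in> G (Y j)" for p j
    using sub[of j] mono[of 0 j] that by (auto simp: Y_def)
  ultimately show ?thesis
    using GZ by (intro exI[of _ "\<lambda>j. G (Y j)"]) blast
qed

text \<open>Factorwise this is \<open>exp (- 2 * x) \<le> 1 - x\<close> on the interval from 0 to
  1/2.\<close>

lemma euler_prod_ge_exp:
  assumes "finite A" "\<And>p. p \<in> A \<Longrightarrow> p \<ge> 2"
  shows "euler_prod A \<ge> exp (- 2 * (\<Sum>p\<in>A. 1 / real p))"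
proof -
  have "exp (- 2 * (\<Sum>p\<in>A. 1 / real p)) = (\<Prod>p\<in>A. exp (- 2 * (1 / real p)))"
    using assms by (simp add: sum_distrib_left exp_sum)
  also have "\<dots> \<le> euler_prod A"
    unfolding euler_prod_def
  proof (rule prod_mono, safe)
    fix p assume "p \<in> A"
    define x where "x = 1 / real p"
    have x: "0 \<le> x" "x \<le> 1 / 2"
      using assms(2)[OF \<open>p \<in> A\<close>] by (auto simp: x_def field_simps)
    have "x * x \<le> (1 / 2) * x"
      using x by (intro mult_right_mono) auto
    then have "- 2 * x \<le> ln (1 - x)"
      using ln_one_minus_pos_lower_bound[OF x] x by (simp add: power2_eq_square)
    then have "exp (- 2 * x) \<le> 1 - x"
      using x by (subst (asm) ln_ge_iff) auto
    then show "exp (- 2 * (1 / real p)) \<le> 1 - 1 / real p"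
      by (simp add: x_def)
  qed simp
  finally show ?thesis .
qed

section \<open>Prime factors along an arithmetic progression\<close>

lemma card_progression_multiples_le:
  fixes p R y X :: nat
  assumes "coprime p R" "p > 0"
  shows "real (card {t\<in>{..<X}. p dvd y + t * R}) \<le> real X / real p + 1"
proof -
  let ?S = "{t\<in>{..<X}. p dvd y + t * R}"
  have cong: "[s = t] (mod p)" if "s \<in> ?S" "t \<in> ?S" for s t
  proof -
    have "[y + s * R = y + t * R] (mod p)"
      using that by (auto simp: cong_def)
    then show ?thesis
      using assms by (simp add: cong_add_lcancel_nat cong_mult_rcancel_nat coprime_commute)
  qed
  \<comment> \<open>All hits lie in one residue class modulo \<open>p\<close>, so the quotient
    determines \<open>t\<close>.\<close>
  have "inj_on (\<lambda>t. t div p) ?S"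
  proof (rule inj_onI)
    fix s t assume st: "s \<in> ?S" "t \<in> ?S" "s div p = t div p"
    have "s mod p = t mod p"
      using cong[OF st(1,2)] by (simp add: cong_def)
    then show "s = t"
      using st(3) by (metis div_mult_mod_eq)
  qed
  moreover have "(\<lambda>t. t div p) ` ?S \<subseteq> {..X div p}"
    by (auto intro!: div_le_mono)
  ultimately have "card ?S \<le> card {..X div p}"
    by (intro card_inj_on_le) auto
  then have "real (card ?S) \<le> real (X div p) + 1"
    by simp
  also have "\<dots> \<le> real X / real p + 1"
    using of_nat_mono[OF div_times_less_eq_dividend[of X p], where ?'a = real] assms
    by (simp add: field_simps)
  finally show ?thesis .
qed

lemma sum_inverse_squares_le: "(\<Sum>n = 2..N. 1 / real n ^ 2) \<le> 1"
proof -
  have "(\<Sum>n = 2..N. 1 / real n ^ 2) \<le> 1 - 1 / real N" if "N \<ge> 1"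
    using that
  proof (induction N rule: dec_induct)
    case (step N)
    have "1 / (real N + 1) ^ 2 \<le> 1 / (real N * (real N + 1))"
      using step by (intro divide_left_mono) (auto simp: power2_eq_square)
    also have "\<dots> = 1 / real N - 1 / (real N + 1)"
      using step by (simp add: field_simps)
    finally show ?case
      using step by (simp add: add.commute)
  qed simp
  then show ?thesis
    by (cases "N \<ge> 1") (force intro: order_trans)+
qed

text \<open>Crude, but any sublinear bound suffices: it is applied with \<open>N\<close> linear in
  the number \<open>X\<close> of terms.\<close>

lemma harm_le_two_sqrt: "(harm n :: real) \<le> 2 * sqrt (real n)"
proof (induction n)
  case 0
  then show ?case by (simp add: harm_expand)
next
  case (Suc n)
  define a where "a = sqrt (real n)"
  define b where "b = sqrt (real (Suc n))"
  have ab: "0 \<le> a" "a \<le> b" "b * b = a * a + 1" "b \<ge> 1"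
    by (auto simp: a_def b_def)
  have "1 = (b - a) * (b + a)"
    using ab by (simp add: algebra_simps)
  also have "\<dots> \<le> (b - a) * (2 * (b * b))"
  proof (rule mult_left_mono)
    have "b * 1 \<le> b * b"
      using ab by (intro mult_left_mono) auto
    then show "b + a \<le> 2 * (b * b)"
      using ab by linarith
  qed (use ab in simp)
  finally have "1 / (b * b) \<le> (b - a) * (2 * (b * b)) / (b * b)"
    by (rule divide_right_mono) simp
  also have "\<dots> = 2 * b - 2 * a"
    using \<open>b \<ge> 1\<close> by simp
  finally have "1 / (b * b) \<le> 2 * b - 2 * a" .
  moreover have "b * b = real (Suc n)"
    by (simp add: b_def)
  ultimately show ?case
    using Suc unfolding harm_Suc inverse_eq_divide a_def b_def by simp
qed

text \<open>After swapping the sums, a prime outside \<open>W\<close> divides at most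
  \<open>X / p + 1\<close> of the terms. The main parts add up to \<open>X\<close> times a sum of
  inverse squares, the extra ones to at most \<open>harm N\<close>.\<close>

lemma sum_progression_prime_reciprocals_le:
  fixes x R X N :: nat
  assumes "\<And>p. prime p \<Longrightarrow> p \<notin> W \<Longrightarrow> coprime p R"
    and "\<And>t. t < X \<Longrightarrow> x + t * R \<le> N" and "x > 0"
  shows "(\<Sum>t<X. \<Sum>p\<in>prime_factors (x + t * R) - W. 1 / real p) \<le> real X + harm N"
proof -
  define P where "P = {p\<in>{2..N}. prime p \<and> p \<notin> W}"
  have "finite P"
    by (simp add: P_def)
  have "(\<Sum>t<X. \<Sum>p\<in>prime_factors (x + t * R) - W. 1 / real p)
      = (\<Sum>t<X. \<Sum>p\<in>P. if p dvd x + t * R then 1 / real p else 0)"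
  proof (rule sum.cong[OF refl])
    fix t assume t: "t \<in> {..<X}"
    have "prime_factors (x + t * R) - W = {p\<in>P. p dvd x + t * R}"
    proof -
      have "p \<le> N" if "p dvd x + t * R" for p
        using dvd_imp_le[OF that] assms(2)[of t] assms(3) t by auto
      then show ?thesis
        using assms(3) by (auto simp: P_def in_prime_factors_iff prime_ge_2_nat)
    qed
    then show "(\<Sum>p\<in>prime_factors (x + t * R) - W. 1 / real p)
        = (\<Sum>p\<in>P. if p dvd x + t * R then 1 / real p else 0)"
      using \<open>finite P\<close> by (simp add: sum.inter_filter)
  qed
  also have "\<dots> = (\<Sum>p\<in>P. \<Sum>t<X. if p dvd x + t * R then 1 / real p else 0)"
    by (rule sum.swap)
  also have "\<dots> = (\<Sum>p\<in>P. real (card {t\<in>{..<X}. p dvd x + t * R}) * (1 / real p))"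
    by (intro sum.cong refl) (simp add: sum.inter_filter[symmetric])
  also have "\<dots> \<le> (\<Sum>p\<in>P. (real X / real p + 1) * (1 / real p))"
    using assms(1) by (intro sum_mono mult_right_mono card_progression_multiples_le) (auto simp: P_def)
  also have "\<dots> = (\<Sum>p\<in>P. real X * (1 / real p ^ 2)) + (\<Sum>p\<in>P. 1 / real p)"
    by (simp add: sum.distrib[symmetric] power2_eq_square algebra_simps)
  also have "\<dots> \<le> (\<Sum>p = 2..N. real X * (1 / real p ^ 2)) + (\<Sum>p = 1..N. 1 / real p)"
    by (intro add_mono sum_mono2) (auto simp: P_def)
  also have "\<dots> = real X * (\<Sum>p = 2..N. 1 / real p ^ 2) + harm N"
    by (simp add: sum_distrib_left harm_def inverse_eq_divide)
  also have "\<dots> \<le> real X * 1 + harm N"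
    by (intro add_right_mono mult_left_mono sum_inverse_squares_le) auto
  finally show ?thesis by simp
qed

lemma ex_small_totient_ratio_run:
  assumes "0 < \<epsilon>" "\<epsilon> \<le> 1"
  shows "\<exists>a K. 1 \<le> a \<and> (\<forall>j\<in>{1..K}. totient_ratio (a + j) < \<epsilon>) \<and>
           1 \<le> (\<Sum>j = 1..K. totient_ratio (a + j))"
proof -
  \<comment> \<open>Each ratio will be about \<open>\<epsilon> / 2 * exp (- 4)\<close> on average,
    so this many terms sum to at least 1.\<close>
  define K where "K = nat \<lceil>2 * exp 4 / \<epsilon>\<rceil>"
  have K: "real K \<ge> 2 * exp 4 / \<epsilon>"
    unfolding K_def by linarith
  let ?J = "{1..K}"
  obtain A :: "nat \<Rightarrow> nat set" where A: "\<And>j. finite (A j)" "\<And>j p. p \<in> A j \<Longrightarrow> prime p"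
    "\<And>j p. p \<in> A j \<Longrightarrow> K < p" "\<And>j. \<epsilon> / 2 \<le> euler_prod (A j)" "\<And>j. euler_prod (A j) < \<epsilon>"
    "\<And>i j. i \<noteq> j \<Longrightarrow> A i \<inter> A j = {}"
    using ex_disjoint_prime_sets[OF assms, of K] by blast
  define Q where "Q j = \<Prod>(A j)" for j
  have Q_pos: "Q j > 0" for j
    unfolding Q_def using A by (intro prod_pos) (auto simp: prime_gt_0_nat)
  have "coprime (Q i) (Q j)" if "i \<noteq> j" for i j
    unfolding Q_def
  proof (intro prod_coprime_left prod_coprime_right)
    fix p p' assume "p \<in> A i" "p' \<in> A j"
    then show "coprime p p'"
      using A(2) A(6)[OF that] by (intro primes_coprime) auto
  qed
  \<comment> \<open>The residue \<open>Q j * j - j\<close> is \<open>-j\<close> modulo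
    \<open>Q j\<close>, written so that subtraction on the naturals does not truncate.\<close>
  then obtain x where x: "\<And>j. j \<in> ?J \<Longrightarrow> [x = Q j * j - j] (mod Q j)"
    using chinese_remainder_nat[of ?J Q "\<lambda>j. Q j * j - j"] by blast
  define R where "R = (\<Prod>j\<in>?J. Q j)"
  define W where "W = (\<Union>j\<in>?J. A j)"
  \<comment> \<open>The extra \<open>R\<close> keeps \<open>m t\<close> positive even if
    \<open>x\<close> is 0.\<close>
  define m where "m t = x + R + t * R" for t
  have R_pos: "R > 0"
    unfolding R_def using Q_pos by (intro prod_pos) auto
  have Q_dvd: "Q j dvd m t + j" if "j \<in> ?J" for j t
  proof -
    have "j \<le> Q j * j"
      using Q_pos[of j] by simp
    then have "[x + j = Q j * j] (mod Q j)"
      using cong_add[OF x[OF that] cong_refl[of j]] by simp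
    then have "Q j dvd x + j"
      by (simp add: cong_def dvd_eq_mod_eq_0)
    moreover have "Q j dvd R"
      unfolding R_def using that by (intro dvd_prodI) auto
    ultimately have "Q j dvd (x + j) + (R + t * R)"
      by (meson dvd_add dvd_mult)
    then show ?thesis
      by (simp add: m_def add_ac)
  qed
  have A_dvd: "p dvd m t + j" if "p \<in> A j" "j \<in> ?J" for p j t
  proof -
    have "p dvd Q j"
      unfolding Q_def using dvd_prodI[OF A(1) that(1), of "\<lambda>p. p"] by simp
    then show ?thesis
      using Q_dvd[OF that(2)] by (rule dvd_trans)
  qed
  have cop: "coprime p R" if "prime p" "p \<notin> W" for p
    unfolding R_def Q_def
  proof (intro prod_coprime_right)
    fix j p' assume "j \<in> ?J" "p' \<in> A j"
    then show "coprime p p'"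
      using that A(2) by (intro primes_coprime) (auto simp: W_def)
  qed
  \<comment> \<open>A prime of \<open>W\<close> exceeds \<open>K\<close>, hence cannot divide two
    different members of a block of length \<open>K\<close>.\<close>
  have factors: "prime_factors (m t + j) \<inter> W \<subseteq> A j" if j: "j \<in> ?J" for t j
  proof
    fix p assume p: "p \<in> prime_factors (m t + j) \<inter> W"
    then obtain i where i: "i \<in> ?J" "p \<in> A i"
      by (auto simp: W_def)
    have "p dvd m t + j" "p dvd m t + i"
      using p A_dvd[OF i(2,1)] by auto
    then have "int p dvd int (m t + i) - int (m t + j)"
      by (intro dvd_diff) (simp_all only: int_dvd_int_iff)
    then have "int p dvd int i - int j"
      by simp
    moreover have "\<bar>int i - int j\<bar> < \<bar>int p\<bar>"
      using A(3)[OF i(2)] i(1) j by auto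
    ultimately have "i = j"
      using dvd_imp_le_int[of "int i - int j" "int p"] by linarith
    then show "p \<in> A j"
      using i by simp
  qed
  define E where "E t j = (\<Sum>p\<in>prime_factors (m t + j) - W. 1 / real p)" for t j
  have lower: "\<epsilon> / 2 * exp (- 2 * E t j) \<le> totient_ratio (m t + j)" if j: "j \<in> ?J" for t j
  proof -
    let ?P = "prime_factors (m t + j)"
    have ge2: "p \<ge> 2" if "p \<in> A j \<or> p \<in> ?P" for p
      using that A(2) by (auto intro: prime_ge_2_nat)
    have "\<epsilon> / 2 * exp (- 2 * E t j) \<le> euler_prod (A j) * euler_prod (?P - W)"
      unfolding E_def using A(4)[of j] ge2 assms by (intro mult_mono euler_prod_ge_exp) auto
    also have "\<dots> = euler_prod (A j \<union> (?P - W))"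
      using A(1) j by (intro euler_prod_Un_disjoint[symmetric]) (auto simp: W_def)
    also have "\<dots> \<le> euler_prod ?P"
      using A(1) ge2 factors[OF j, of t] by (intro euler_prod_antimono) auto
    also have "\<dots> = totient_ratio (m t + j)"
      using R_pos by (simp add: totient_ratio_eq_euler_prod m_def)
    finally show ?thesis .
  qed
  \<comment> \<open>For such \<open>X\<close> the harmonic term is at most \<open>X\<close>, so each
    \<open>E t j\<close> averages at most 2 over \<open>t\<close>.\<close>
  have "\<forall>\<^sub>F X in sequentially. 2 * sqrt (real (x + R + K) + real X * real R) \<le> real X"
    using R_pos by real_asymp
  then obtain X where X: "X > 0" "2 * sqrt (real (x + R + K) + real X * real R) \<le> real X"
    by (metis (no_types, lifting) eventually_sequentially le_add1 le_add2 less_le_trans zero_less_one)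
  have "(\<Sum>t<X. E t j) \<le> 2 * real X" if j: "j \<in> ?J" for j
  proof -
    define N where "N = x + R + K + X * R"
    have "(\<Sum>t<X. \<Sum>p\<in>prime_factors (x + R + j + t * R) - W. 1 / real p) \<le> real X + harm N"
    proof (rule sum_progression_prime_reciprocals_le)
      show "x + R + j + t * R \<le> N" if "t < X" for t
        using that j unfolding N_def by (intro add_mono mult_right_mono) auto
    qed (use cop R_pos in auto)
    also have "harm N \<le> 2 * sqrt (real N)"
      by (rule harm_le_two_sqrt)
    also have "\<dots> \<le> real X"
      using X(2) by (simp add: N_def)
    finally show ?thesis
      by (simp add: E_def m_def add_ac)
  qed
  then have "(\<Sum>j\<in>?J. \<Sum>t<X. E t j) \<le> (\<Sum>j\<in>?J. 2 * real X)"
    by (intro sum_mono) auto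
  then have total: "(\<Sum>t<X. \<Sum>j\<in>?J. E t j) \<le> (\<Sum>t<X. 2 * real K)"
    by (subst sum.swap) (simp add: mult_ac)
  \<comment> \<open>Some block does no worse than the average.\<close>
  obtain t where t: "(\<Sum>j\<in>?J. E t j) \<le> 2 * real K"
  proof (rule ccontr)
    assume "\<not> thesis"
    then have "2 * real K < (\<Sum>j\<in>?J. E t j)" for t
      using that[of t] by (auto simp: not_le[symmetric])
    then have "(\<Sum>t<X. 2 * real K) < (\<Sum>t<X. \<Sum>j\<in>?J. E t j)"
      using X(1) by (intro sum_strict_mono) auto
    with total show False by simp
  qed
  \<comment> \<open>Jensen's inequality for \<open>exp (-2 E)\<close>, through the tangent line at \<open>E = 2\<close>.\<close>
  have tangent: "exp (- 4) * (5 - 2 * y) \<le> exp (- 2 * y)" for y :: real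
  proof -
    have "exp (- 4) * (1 + (4 - 2 * y)) \<le> exp (- 4) * exp (4 - 2 * y)"
      by (intro mult_left_mono exp_ge_add_one_self) simp
    then show ?thesis
      by (simp add: exp_add[symmetric])
  qed
  have "1 \<le> \<epsilon> / 2 * (exp (- 4) * real K)"
    using K assms by (simp add: exp_minus field_simps)
  also have "\<dots> \<le> \<epsilon> / 2 * (exp (- 4) * (\<Sum>j\<in>?J. 5 - 2 * E t j))"
    using t assms by (intro mult_left_mono) (auto simp: sum_subtractf sum_distrib_left[symmetric])
  also have "\<dots> = (\<Sum>j\<in>?J. \<epsilon> / 2 * (exp (- 4) * (5 - 2 * E t j)))"
    by (simp add: sum_distrib_left)
  also have "\<dots> \<le> (\<Sum>j\<in>?J. totient_ratio (m t + j))"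
  proof (rule sum_mono)
    fix j assume j: "j \<in> ?J"
    have "\<epsilon> / 2 * (exp (- 4) * (5 - 2 * E t j)) \<le> \<epsilon> / 2 * exp (- 2 * E t j)"
      using assms by (intro mult_left_mono tangent) auto
    then show "\<epsilon> / 2 * (exp (- 4) * (5 - 2 * E t j)) \<le> totient_ratio (m t + j)"
      using lower[OF j, of t] by linarith
  qed
  finally have "1 \<le> (\<Sum>j\<in>?J. totient_ratio (m t + j))" .
  moreover have "totient_ratio (m t + j) < \<epsilon>" if j: "j \<in> ?J" for j
  proof -
    have "A j \<subseteq> prime_factors (m t + j)"
      using A(2) A_dvd j R_pos by (auto simp: in_prime_factors_iff m_def)
    then have "totient_ratio (m t + j) \<le> euler_prod (A j)"
      using R_pos by (subst totient_ratio_eq_euler_prod)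
        (auto simp: m_def intro!: euler_prod_antimono prime_ge_2_nat)
    then show ?thesis
      using A(5)[of j] by linarith
  qed
  moreover have "1 \<le> m t"
    using R_pos by (simp add: m_def)
  ultimately show ?thesis by blast
qed

section \<open>Density of the partial sums\<close>

lemma totient_ratio_sum_Suc:
  "totient_ratio_sum c (Suc n) = totient_ratio_sum c n + totient_ratio (nat \<lfloor>real (Suc n) powr c\<rfloor>)"
  by (simp add: totient_ratio_sum_def totient_ratio_def)

lemma totient_ratio_sum_add:
  "totient_ratio_sum c (a + K) =
     totient_ratio_sum c a + (\<Sum>j = 1..K. totient_ratio (nat \<lfloor>real (a + j) powr c\<rfloor>))"
  by (induction K) (simp_all add: totient_ratio_sum_Suc add_ac)

lemma dense_mod_1_totient_ratio_sum_if_runs: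
  assumes "\<And>\<epsilon>. 0 < \<epsilon> \<Longrightarrow> \<epsilon> \<le> 1 \<Longrightarrow> \<exists>a K. 1 \<le> a \<and>
      (\<forall>j\<in>{1..K}. totient_ratio (nat \<lfloor>real (a + j) powr c\<rfloor>) \<le> \<epsilon>) \<and>
      1 \<le> (\<Sum>j = 1..K. totient_ratio (nat \<lfloor>real (a + j) powr c\<rfloor>))"
  shows "dense_mod_1 (totient_ratio_sum c)"
proof (rule dense_mod_1_if_small_step_runs)
  fix \<epsilon> :: real assume "\<epsilon> > 0"
  then obtain a K where aK: "1 \<le> a"
      "\<And>j. j \<in> {1..K} \<Longrightarrow> totient_ratio (nat \<lfloor>real (a + j) powr c\<rfloor>) \<le> min \<epsilon> 1"
      "1 \<le> (\<Sum>j = 1..K. totient_ratio (nat \<lfloor>real (a + j) powr c\<rfloor>))"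
    using assms[of "min \<epsilon> 1"] by (metis min.cobounded2 min_less_iff_conj zero_less_one)
  have "totient_ratio_sum c (Suc n) \<le> totient_ratio_sum c n + \<epsilon>" if "n \<in> {a..<a + K}" for n
    using aK(2)[of "Suc n - a"] that by (auto simp: totient_ratio_sum_Suc Suc_diff_le)
  then show "\<exists>a b. 1 \<le> a \<and> a \<le> b \<and> totient_ratio_sum c a + 1 \<le> totient_ratio_sum c b \<and>
      (\<forall>n\<in>{a..<b}. totient_ratio_sum c (Suc n) \<le> totient_ratio_sum c n + \<epsilon>)"
    using aK(1,3) by (intro exI[of _ a] exI[of _ "a + K"]) (auto simp: totient_ratio_sum_add)
qed

lemma dense_mod_1_totient_ratio_sum_int:
  fixes c :: real
  assumes "c > 1" "c \<in> \<int>"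
  shows "dense_mod_1 (totient_ratio_sum c)"
proof (rule dense_mod_1_totient_ratio_sum_if_runs)
  fix \<epsilon> :: real assume \<epsilon>: "0 < \<epsilon>" "\<epsilon> \<le> 1"
  obtain k where k: "c = real k" "k > 0"
  proof -
    obtain i where "c = of_int i"
      using assms(2) by (rule Ints_cases)
    then show ?thesis
      using assms(1) that[of "nat i"] by simp
  qed
  have "totient_ratio (nat \<lfloor>real m powr c\<rfloor>) = totient_ratio m" if "m > 0" for m
  proof -
    have "real m powr c = real (m ^ k)"
      using that by (simp add: k powr_realpow)
    then have "nat \<lfloor>real m powr c\<rfloor> = m ^ k"
      by (simp only: floor_of_nat nat_int)
    then show ?thesis
      using k by (simp add: totient_ratio_power)
  qed
  then have eq: "totient_ratio (nat \<lfloor>real (a + j) powr c\<rfloor>) = totient_ratio (a + j)" if "1 \<le> a" for a j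
    using that by (simp del: of_nat_add)
  show "\<exists>a K. 1 \<le> a \<and> (\<forall>j\<in>{1..K}. totient_ratio (nat \<lfloor>real (a + j) powr c\<rfloor>) \<le> \<epsilon>) \<and>
      1 \<le> (\<Sum>j = 1..K. totient_ratio (nat \<lfloor>real (a + j) powr c\<rfloor>))"
    using ex_small_totient_ratio_run[OF \<epsilon>] eq by (metis (no_types, lifting) less_imp_le sum.cong)
qed

lemma dense_mod_1_totient_ratio_sum_nonint:
  fixes c :: real
  assumes c: "c > 1" "c \<notin> \<int>"
  shows "dense_mod_1 (totient_ratio_sum c)"
proof (rule dense_mod_1_totient_ratio_sum_if_runs)
  fix \<epsilon> :: real assume \<epsilon>: "0 < \<epsilon>" "\<epsilon> \<le> 1"
  obtain q where q: "q > 0" "totient_ratio q < \<epsilon>"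
    using ex_totient_ratio_less[OF \<epsilon>(1)] by blast
  obtain b T where b: "1 \<le> b" and T: "1 + c * log 2 (real (b + T)) \<le> real T"
    and dvd: "\<And>m. m \<in> {b..b + T} \<Longrightarrow> q dvd nat \<lfloor>real m powr c\<rfloor>"
    using ex_long_divisible_run[OF c q(1)] by blast
  have pos: "nat \<lfloor>real (b + j) powr c\<rfloor> > 0" for j
    using b c by (simp add: ge_one_powr_ge_zero)
  have "totient_ratio (nat \<lfloor>real (b + j) powr c\<rfloor>) \<le> \<epsilon>" if "j \<in> {1..T}" for j
    using totient_ratio_dvd_mono[OF dvd[of "b + j"] pos] that q by auto
  \<comment> \<open>By the choice of \<open>T\<close>, the logarithmic lower bound is at least
    \<open>1 / T\<close> for every member of the block, and there are \<open>T\<close> of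
    them.\<close>
  moreover have "1 / real T \<le> totient_ratio (nat \<lfloor>real (b + j) powr c\<rfloor>)" if j: "j \<in> {1..T}" for j
  proof -
    let ?n = "nat \<lfloor>real (b + j) powr c\<rfloor>"
    have "log 2 (real ?n) \<le> log 2 (real (b + j) powr c)"
      using pos[of j] b by (subst log_le_cancel_iff) auto
    also have "\<dots> = c * log 2 (real (b + j))"
      using b by (simp add: log_powr)
    also have "\<dots> \<le> c * log 2 (real (b + T))"
      using c b j by (intro mult_left_mono) auto
    finally have "log 2 (real ?n) + 1 \<le> real T"
      using T by simp
    moreover have "log 2 (real ?n) \<ge> 0"
      using pos[of j] by simp
    ultimately have "1 / real T \<le> 1 / (log 2 (real ?n) + 1)"
      by (intro divide_left_mono) auto
    also have "\<dots> \<le> totient_ratio ?n"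
      by (rule totient_ratio_ge_log[OF pos])
    finally show ?thesis .
  qed
  then have "(\<Sum>j = 1..T. 1 / real T) \<le> (\<Sum>j = 1..T. totient_ratio (nat \<lfloor>real (b + j) powr c\<rfloor>))"
    by (intro sum_mono) auto
  \<comment> \<open>Rules out \<open>T = 0\<close>, where the sum of \<open>T\<close> copies of
    \<open>1 / T\<close> would be 0 instead of 1.\<close>
  moreover have "log 2 (real (b + T)) \<ge> 0"
    using b by simp
  then have "c * log 2 (real (b + T)) \<ge> 0"
    using c by (intro mult_nonneg_nonneg) auto
  then have "T > 0"
    using T by (intro Nat.gr0I) auto
  ultimately show "\<exists>a K. 1 \<le> a \<and>
      (\<forall>j\<in>{1..K}. totient_ratio (nat \<lfloor>real (a + j) powr c\<rfloor>) \<le> \<epsilon>) \<and>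
      1 \<le> (\<Sum>j = 1..K. totient_ratio (nat \<lfloor>real (a + j) powr c\<rfloor>))"
    using b by (intro exI[of _ b] exI[of _ T]) auto
qed

theorem theorem2:
  fixes c :: real
  assumes "c > 1"
  shows "dense_mod_1 (totient_ratio_sum c)"
  using assms dense_mod_1_totient_ratio_sum_int dense_mod_1_totient_ratio_sum_nonint by blast

end
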